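(* For every countably infinite forest $T$, $\mathrm{Rd}_2(T)\geq 1/2$; that is, every 2-coloring of the edges of $K_\mathbb{N}$ contains, for every $\varepsilon>0$, a monochromatic copy of $T$ whose vertex set has upper density at least $1/2-\varepsilon$.
   Context: $K_{\mathbb{N}}$ is the complete graph on $\mathbb{N}=\{1,2,\dots\}$. A copy of $T$ is a subgraph of $K_\mathbb{N}$ isomorphic to $T$; monochromatic means all its edges have the same color. $\overline{d}(V)=\limsup_{t\to\infty}|V\cap\{1,\dots,t\}|/t$. For a 2-coloring $\varphi$, $\mathrm{Rd}_\varphi(T)$ is the supremum of $\overline{d}(V(T'))$ over monochromatic copies $T'$ of $T$, and $\mathrm{Rd}_2(T)=\inf_\varphi \mathrm{Rd}_\varphi(T)$. *)

theory Defs
  imports "HOL-Analysis.Analysis" "HOL-Library.Liminf_Limsup"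
begin

definition simple_graph :: "'a set \<Rightarrow> 'a set set \<Rightarrow> bool" where
  "simple_graph V E \<longleftrightarrow> (\<forall>e\<in>E. \<exists>u v. u \<noteq> v \<and> u \<in> V \<and> v \<in> V \<and> e = {u, v})"

definition is_cycle :: "'a set set \<Rightarrow> 'a list \<Rightarrow> bool" where
  "is_cycle E cs \<longleftrightarrow> length cs \<ge> 3 \<and> distinct cs \<and>
     (\<forall>i. Suc i < length cs \<longrightarrow> {cs ! i, cs ! Suc i} \<in> E) \<and>
     {last cs, hd cs} \<in> E"

definition forest :: "'a set \<Rightarrow> 'a set set \<Rightarrow> bool" where
  "forest V E \<longleftrightarrow> simple_graph V E \<and> (\<nexists>cs. is_cycle E cs)"

definition upper_density :: "nat set \<Rightarrow> ereal" where
  "upper_density A = limsup (\<lambda>t. ereal (real (card (A \<inter> {1..t})) / real t))"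

text \<open>A 2-colouring of the edges of K_N: colour of edge {x,y} is phi {x,y}.
  A monochromatic copy of T=(V,E) in K_N (N = positive integers) is given by an injective
  map f from V into N sending every edge of T to an edge of colour c; its vertex set is f ` V.\<close>
definition mono_copy :: "(nat set \<Rightarrow> bool) \<Rightarrow> 'a set \<Rightarrow> 'a set set \<Rightarrow> ('a \<Rightarrow> nat) \<Rightarrow> bool" where
  "mono_copy phi V E f \<longleftrightarrow> inj_on f V \<and> f ` V \<subseteq> {1..} \<and>
     (\<exists>c. \<forall>e\<in>E. phi (f ` e) = c)"

definition Rd_col :: "(nat set \<Rightarrow> bool) \<Rightarrow> 'a set \<Rightarrow> 'a set set \<Rightarrow> ereal" where
  "Rd_col phi V E = Sup {upper_density (f ` V) | f. mono_copy phi V E f}"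

definition Rd2 :: "'a set \<Rightarrow> 'a set set \<Rightarrow> ereal" where
  "Rd2 V E = Inf {Rd_col phi V E | phi. True}"

end

theory Submission
  imports Defs
begin

text \<open>Enumerate the vertices so that each has at most one earlier neighbour, and embed greedily,
  always using the least admissible number; a number that is admissible infinitely often is used.

  If some vertex of the forest has infinite degree, let the core of a colour be the largest set in
  which every vertex has infinitely many neighbours of that colour. A greedy embedding that stays in
  the core and maps the vertex of infinite degree to v covers all neighbours of v in the core.
  Outside the core of one colour, almost all vertices lie in the core of the other. If both cores
  are cofinite, the two neighbourhoods of a common v cover almost everything. If infinitely many
  vertices miss one core, then some vertex of the other core is joined to almost everything in that
  other colour, so it covers almost all of that core.

  If the forest is locally finite, colour the vertices so that any finite set of vertices of colour b
  has infinitely many common neighbours in colour b. For either b, the vertices of even depth can be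
  made to cover colour class b, with those of odd depth going to common neighbours.\<close>

section \<open>Upper density\<close>

lemma upper_density_mono:
  assumes "A \<subseteq> B"
  shows "upper_density A \<le> upper_density B"
  unfolding upper_density_def
proof (rule Limsup_mono, rule always_eventually, rule allI)
  fix t
  have "card (A \<inter> {1..t}) \<le> card (B \<inter> {1..t})"
    using assms by (intro card_mono) auto
  then show "ereal (real (card (A \<inter> {1..t})) / real t) \<le> ereal (real (card (B \<inter> {1..t})) / real t)"
    by (simp add: divide_right_mono)
qed

lemma ereal_half: "(1/2 :: ereal) = ereal (1/2)"
  by (simp add: one_ereal_def)

lemma upper_density_less_half:
  assumes "upper_density A < 1/2"
  obtains r :: real where "r < 1/2"
    "eventually (\<lambda>t. real (card (A \<inter> {1..t})) / real t < r) sequentially"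
proof -
  obtain r where r: "upper_density A < ereal r" "ereal r < 1/2"
    using ereal_dense2[OF assms] by auto
  show ?thesis
  proof (rule that[of r])
    show "r < 1/2" using r(2) unfolding ereal_half by simp
    show "eventually (\<lambda>t. real (card (A \<inter> {1..t})) / real t < r) sequentially"
      using Limsup_lessD[OF r(1)[unfolded upper_density_def]] by simp
  qed
qed

text \<open>If both upper densities were below 1/2, the proportions of \<open>A\<close> and
  \<open>B\<close> in \<open>{1..t}\<close> would eventually stay below reals \<open>r\<close>,
  \<open>s\<close> with \<open>r + s < 1\<close>. The share of \<open>F\<close> tends to 0, so the
  three sets could not fill \<open>{1..t}\<close>.\<close>

lemma upper_density_cover:
  assumes "{1..} \<subseteq> A \<union> B \<union> F" "finite F"
  shows "upper_density A \<ge> 1/2 \<or> upper_density B \<ge> 1/2"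
proof (rule ccontr)
  assume "\<not> ?thesis"
  then have less: "upper_density A < 1/2" "upper_density B < 1/2" by auto
  obtain r where r: "r < 1/2" "eventually (\<lambda>t. real (card (A \<inter> {1..t})) / real t < r) sequentially"
    using upper_density_less_half[OF less(1)] .
  obtain s where s: "s < 1/2" "eventually (\<lambda>t. real (card (B \<inter> {1..t})) / real t < s) sequentially"
    using upper_density_less_half[OF less(2)] .
  have "(\<lambda>t. real (card F) / real t) \<longlonglongrightarrow> 0"
    by (rule lim_const_over_n)
  then have "eventually (\<lambda>t. real (card F) / real t < 1 - r - s) sequentially"
    using r(1) s(1) by (intro order_tendstoD(2)) auto
  with r(2) s(2) eventually_gt_at_top[of 0]
  have "eventually (\<lambda>t::nat. False) sequentially"
  proof eventually_elim
    case (elim t)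
    have "{1..t} \<subseteq> (A \<inter> {1..t}) \<union> (B \<inter> {1..t}) \<union> F"
      using assms(1) by auto
    then have "card {1..t} \<le> card ((A \<inter> {1..t}) \<union> (B \<inter> {1..t}) \<union> F)"
      using assms(2) by (intro card_mono) auto
    also have "\<dots> \<le> card ((A \<inter> {1..t}) \<union> (B \<inter> {1..t})) + card F"
      by (rule card_Un_le)
    also have "\<dots> \<le> card (A \<inter> {1..t}) + card (B \<inter> {1..t}) + card F"
      using card_Un_le[of "A \<inter> {1..t}" "B \<inter> {1..t}"] by simp
    finally have "real t \<le> real (card (A \<inter> {1..t})) + real (card (B \<inter> {1..t})) + real (card F)"
      by simp
    then have "real t / real t \<le> (real (card (A \<inter> {1..t})) + real (card (B \<inter> {1..t})) + real (card F)) / real t"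
      by (rule divide_right_mono) simp
    then have "1 \<le> real (card (A \<inter> {1..t})) / real t + real (card (B \<inter> {1..t})) / real t
        + real (card F) / real t"
      using elim by (simp add: add_divide_distrib)
    then show False using elim by linarith
  qed
  then show False by simp
qed

lemma upper_density_finite:
  assumes "finite A"
  shows "upper_density A < 1/2"
proof -
  have "upper_density A \<le> 0"
    unfolding upper_density_def
  proof (rule Limsup_le_iff[THEN iffD2], intro allI impI)
    fix y :: ereal
    assume "y > 0"
    have "(\<lambda>t. real (card A) / real t) \<longlonglongrightarrow> 0"
      by (rule lim_const_over_n)
    then have "(\<lambda>t. ereal (real (card A) / real t)) \<longlonglongrightarrow> 0"
      by (simp add: zero_ereal_def)
    then have "eventually (\<lambda>t. ereal (real (card A) / real t) < y) sequentially"
      using \<open>y > 0\<close> by (rule order_tendstoD(2))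
    then show "eventually (\<lambda>t. ereal (real (card (A \<inter> {1..t})) / real t) < y) sequentially"
    proof eventually_elim
      case (elim t)
      have "card (A \<inter> {1..t}) \<le> card A"
        using assms by (intro card_mono) auto
      then have "ereal (real (card (A \<inter> {1..t})) / real t) \<le> ereal (real (card A) / real t)"
        by (simp add: divide_right_mono)
      then show ?case using elim by (rule le_less_trans)
    qed
  qed
  also have "(0::ereal) < 1/2" unfolding ereal_half by simp
  finally show ?thesis .
qed

section \<open>Greedy injections\<close>

text \<open>Each \<open>x\<close> takes the least admissible value not taken before it. The order is
  a general \<open>R\<close> because locally finite trees will not be embedded in the order of their
  numbering. \<open>local\<close> makes the recursion well defined.\<close>

lemma greedy_injection:
  fixes R :: "('b \<times> 'b) set" and A :: "('b \<Rightarrow> nat) \<Rightarrow> 'b \<Rightarrow> nat set"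
  assumes wf: "wf R" and total: "\<And>x y. x \<noteq> y \<Longrightarrow> (x, y) \<in> R \<or> (y, x) \<in> R"
    and local: "\<And>f g x. (\<And>y. (y, x) \<in> R \<Longrightarrow> f y = g y) \<Longrightarrow> A f x = A g x"
    and avail: "\<And>f x. (\<And>y. (y, x) \<in> R \<Longrightarrow> f y \<in> A f y) \<Longrightarrow> \<not> A f x \<subseteq> f ` {y. (y, x) \<in> R}"
  obtains g where "inj g" "\<And>x. g x \<in> A g x"
    "\<And>w. infinite {x. w \<in> A g x} \<Longrightarrow> w \<in> range g"
proof -
  define P where "P f x r \<longleftrightarrow> r \<in> A f x \<and> r \<notin> f ` {y. (y, x) \<in> R} \<and>
      (\<forall>w\<in>A f x. w \<notin> f ` {y. (y, x) \<in> R} \<longrightarrow> r \<le> w)" for f x r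
  have "\<exists>f. \<forall>x. P f x (f x)"
  proof (rule dependent_wf_choice[OF wf])
    fix f g :: "'b \<Rightarrow> nat" and x r
    assume eq: "\<And>z. (z, x) \<in> R \<Longrightarrow> f z = g z"
    then have "f ` {y. (y, x) \<in> R} = g ` {y. (y, x) \<in> R}" by (auto simp: image_iff)
    with local[OF eq] show "P f x r = P g x r" unfolding P_def by simp
  next
    fix x f
    assume "\<And>y. (y, x) \<in> R \<Longrightarrow> P f y (f y)"
    then have "\<not> A f x \<subseteq> f ` {y. (y, x) \<in> R}"
      by (intro avail) (simp add: P_def)
    then have ex: "\<exists>w. w \<in> A f x - f ` {y. (y, x) \<in> R}" by blast
    have "P f x (LEAST w. w \<in> A f x - f ` {y. (y, x) \<in> R})"
      using LeastI_ex[OF ex] Least_le[of "\<lambda>w. w \<in> A f x - f ` {y. (y, x) \<in> R}"]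
      unfolding P_def by blast
    then show "\<exists>r. P f x r" by blast
  qed
  then obtain g where g: "\<And>x. P g x (g x)" by blast
  have "inj g"
  proof (rule injI, rule ccontr)
    fix x y assume "g x = g y" "x \<noteq> y"
    with total[OF this(2)] g[of x] g[of y] show False
      unfolding P_def by (metis (mono_tags, lifting) imageI mem_Collect_eq)
  qed
  moreover have "w \<in> range g" if inf: "infinite {x. w \<in> A g x}" for w
  proof (rule ccontr)
    assume "w \<notin> range g"
    then have "g ` {x. w \<in> A g x} \<subseteq> {..w}"
      using g unfolding P_def by blast
    then have "finite (g ` {x. w \<in> A g x})"
      by (rule finite_subset) simp
    then show False
      using inf \<open>inj g\<close> by (meson finite_imageD inj_on_subset subset_UNIV)
  qed
  ultimately show ?thesis
    using g that unfolding P_def by blast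
qed

section \<open>Trees with a vertex of infinite degree\<close>

text \<open>The term w = u contributes the meaningless value phi {u}, which does not affect whether the
  set is infinite.\<close>

definition inf_closed :: "(nat set \<Rightarrow> bool) \<Rightarrow> bool \<Rightarrow> nat set \<Rightarrow> bool" where
  "inf_closed phi c C \<longleftrightarrow> C \<subseteq> {1..} \<and> (\<forall>u\<in>C. infinite {w\<in>C. phi {u, w} = c})"

definition core :: "(nat set \<Rightarrow> bool) \<Rightarrow> bool \<Rightarrow> nat set" where
  "core phi c = \<Union> {C. inf_closed phi c C}"

text \<open>Enlarging a set only enlarges neighbourhoods inside it, so unions of
  \<open>inf_closed\<close> sets are \<open>inf_closed\<close>.\<close>

lemma inf_closed_core: "inf_closed phi c (core phi c)"
  unfolding inf_closed_def
proof (intro conjI ballI)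
  show "core phi c \<subseteq> {1..}"
    unfolding core_def inf_closed_def by blast
  fix u assume "u \<in> core phi c"
  then obtain C where C: "inf_closed phi c C" "u \<in> C"
    unfolding core_def by blast
  then have "C \<subseteq> core phi c" unfolding core_def by blast
  then have "{w\<in>C. phi {u, w} = c} \<subseteq> {w\<in>core phi c. phi {u, w} = c}" by blast
  then show "infinite {w\<in>core phi c. phi {u, w} = c}"
    using C unfolding inf_closed_def by (meson finite_subset)
qed

lemma inf_closed_subset_core: "inf_closed phi c C \<Longrightarrow> C \<subseteq> core phi c"
  unfolding core_def by blast

text \<open>Maximality of the core: if every vertex of \<open>X\<close> had infinite degree,
  \<open>X\<close> could be added to it.\<close>

lemma finite_degree_outside_core:
  assumes "X \<subseteq> {1..} - core phi c" "X \<noteq> {}"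
  obtains v where "v \<in> X" "finite {w \<in> core phi c \<union> X. phi {v, w} = c}"
proof -
  have "\<exists>v\<in>X. finite {w \<in> core phi c \<union> X. phi {v, w} = c}"
  proof (rule ccontr)
    assume "\<not> ?thesis"
    then have inf: "infinite {w \<in> core phi c \<union> X. phi {v, w} = c}" if "v \<in> X" for v
      using that by blast
    have "inf_closed phi c (core phi c \<union> X)"
      unfolding inf_closed_def
    proof (intro conjI ballI)
      show "core phi c \<union> X \<subseteq> {1..}"
        using assms(1) inf_closed_core[of phi c] unfolding inf_closed_def by blast
      fix u assume "u \<in> core phi c \<union> X"
      moreover have "{w \<in> core phi c. phi {u, w} = c} \<subseteq> {w \<in> core phi c \<union> X. phi {u, w} = c}"
        by blast
      ultimately show "infinite {w \<in> core phi c \<union> X. phi {u, w} = c}"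
        using inf inf_closed_core[of phi c] unfolding inf_closed_def
        by (meson UnE finite_subset)
    qed
    then have "X \<subseteq> core phi c" using inf_closed_subset_core by blast
    with assms show False by blast
  qed
  then show ?thesis using that by blast
qed

text \<open>Otherwise remove, one after another, vertices with finitely many
  \<open>c\<close>-neighbours among those still present. Each removed vertex is joined in the other
  colour to almost all later ones, so together they form an \<open>inf_closed\<close> set for that
  colour, contradicting their choice outside its core.\<close>

lemma finite_outside_cores:
  fixes phi :: "nat set \<Rightarrow> bool"
  shows "finite ({1..} - core phi c - core phi (\<not> c))"
proof (rule ccontr)
  let ?X = "{1..} - core phi c - core phi (\<not> c)"
  assume inf: "infinite ?X"
  define Q where "Q Y v \<longleftrightarrow> v \<in> Y \<and> finite {w \<in> Y. phi {v, w} = c}" for Y v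
  have step: "\<exists>v. Q Y v" if Y: "Y \<subseteq> ?X" "infinite Y" for Y
  proof -
    have "Y \<subseteq> {1..} - core phi c" "Y \<noteq> {}" using Y by auto
    then obtain v where v: "v \<in> Y" "finite {w \<in> core phi c \<union> Y. phi {v, w} = c}"
      by (rule finite_degree_outside_core)
    have "finite {w \<in> Y. phi {v, w} = c}"
      using v(2) by (rule rev_finite_subset) blast
    with v(1) show ?thesis unfolding Q_def by blast
  qed
  have "\<exists>Y. \<forall>n. (Y n \<subseteq> ?X \<and> infinite (Y n)) \<and> (\<exists>v. Q (Y n) v \<and> Y (Suc n) = Y n - {v})"
  proof (rule dependent_nat_choice)
    show "\<exists>Y. Y \<subseteq> ?X \<and> infinite Y" using inf by blast
    fix Y and n :: nat assume "Y \<subseteq> ?X \<and> infinite Y"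
    with step[of Y] obtain v where "Q Y v" by blast
    with \<open>Y \<subseteq> ?X \<and> infinite Y\<close>
    show "\<exists>Z. (Z \<subseteq> ?X \<and> infinite Z) \<and> (\<exists>v. Q Y v \<and> Z = Y - {v})"
      by (intro exI[of _ "Y - {v}"]) auto
  qed
  then obtain Y where Y: "\<And>n. Y n \<subseteq> ?X" "\<And>n. \<exists>v. Q (Y n) v \<and> Y (Suc n) = Y n - {v}"
    by blast
  then obtain v where v: "\<And>n. Q (Y n) (v n)" "\<And>n. Y (Suc n) = Y n - {v n}"
    by metis
  have anti: "Y n \<subseteq> Y m" if "m \<le> n" for m n
    using that by (rule lift_Suc_antimono_le[rotated]) (use v(2) in blast)
  have in_Y: "v n \<in> Y n" for n using v(1) unfolding Q_def by blast
  have "v m \<noteq> v n" if "m < n" for m n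
  proof -
    have "v n \<in> Y (Suc m)" using anti[of "Suc m" n] in_Y[of n] that by auto
    then show ?thesis using v(2)[of m] by auto
  qed
  then have inj: "inj v" by (metis injI linorder_neqE_nat)
  have "inf_closed phi (\<not> c) (range v)"
    unfolding inf_closed_def
  proof (intro conjI ballI)
    show "range v \<subseteq> {1..}" using in_Y Y(1) by blast
    fix u assume "u \<in> range v"
    then obtain m where m: "u = v m" by blast
    have "infinite (v ` {m..})"
      using inj by (meson finite_imageD infinite_Ici inj_on_subset subset_UNIV)
    moreover have "v ` {m..} \<subseteq> Y m" using in_Y anti by auto
    moreover have "finite {w \<in> Y m. phi {v m, w} = c}" using v(1)[of m] unfolding Q_def by blast
    ultimately have "infinite (v ` {m..} - {w \<in> Y m. phi {v m, w} = c})"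
      by (meson Diff_infinite_finite)
    moreover have "v ` {m..} - {w \<in> Y m. phi {v m, w} = c} \<subseteq> {w \<in> range v. phi {u, w} = (\<not> c)}"
      using \<open>v ` {m..} \<subseteq> Y m\<close> m by blast
    ultimately show "infinite {w \<in> range v. phi {u, w} = (\<not> c)}"
      by (meson finite_subset)
  qed
  then have "v 0 \<in> core phi (\<not> c)" using inf_closed_subset_core by blast
  then show False using in_Y[of 0] Y(1)[of 0] by blast
qed

text \<open>With \<open>X\<close> the whole complement of the core, the finite degree found above
  counts all \<open>c\<close>-neighbours. Such a \<open>v\<close> is joined in the other colour to
  almost all of the other core, which is infinite, so \<open>v\<close> can be added to that core and
  hence lies in it.\<close>

lemma cofinite_degree_in_core:
  assumes "infinite ({1..} - core phi c)"
  obtains v where "v \<in> core phi (\<not> c)" "finite {w \<in> {1..}. phi {v, w} = c}"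
proof -
  have "{1..} - core phi c \<noteq> {}" using assms by (metis finite.emptyI)
  then obtain v where v: "v \<in> {1..} - core phi c"
    "finite {w \<in> core phi c \<union> ({1..} - core phi c). phi {v, w} = c}"
    by (rule finite_degree_outside_core[OF order_refl])
  have "core phi c \<subseteq> {1..}" using inf_closed_core unfolding inf_closed_def by blast
  then have "core phi c \<union> ({1..} - core phi c) = {1..}" by blast
  with v(2) have fin: "finite {w \<in> {1..}. phi {v, w} = c}" by (simp only:)
  have "infinite (({1..} - core phi c) - ({1..} - core phi c - core phi (\<not> c)))"
    using assms finite_outside_cores by (rule Diff_infinite_finite[rotated])
  then have inf: "infinite (core phi (\<not> c))"
    by (rule contrapos_nn) (erule rev_finite_subset, blast)
  have core: "inf_closed phi (\<not> c) (core phi (\<not> c))" by (rule inf_closed_core)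
  have "inf_closed phi (\<not> c) (insert v (core phi (\<not> c)))"
    unfolding inf_closed_def
  proof (intro conjI ballI)
    show "insert v (core phi (\<not> c)) \<subseteq> {1..}"
      using v(1) core unfolding inf_closed_def by blast
    fix u assume u: "u \<in> insert v (core phi (\<not> c))"
    have "infinite {w \<in> core phi (\<not> c). phi {u, w} = (\<not> c)}"
    proof (cases "u = v")
      case True
      have "infinite (core phi (\<not> c) - {w \<in> {1..}. phi {v, w} = c})"
        using inf fin by (rule Diff_infinite_finite[rotated])
      then show ?thesis
        by (rule contrapos_nn)
          (erule rev_finite_subset, use True core in \<open>auto simp: inf_closed_def\<close>)
    next
      case False
      then show ?thesis using u core unfolding inf_closed_def by blast
    qed
    then show "infinite {w \<in> insert v (core phi (\<not> c)). phi {u, w} = (\<not> c)}"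
      by (rule contrapos_nn) (erule rev_finite_subset, blast)
  qed
  then have "v \<in> core phi (\<not> c)" using inf_closed_subset_core by blast
  then show ?thesis using fin that by blast
qed

lemma dense_neighbourhood_in_core:
  fixes phi :: "nat set \<Rightarrow> bool"
  obtains c v where "v \<in> core phi c" "upper_density {w \<in> core phi c. phi {v, w} = c} \<ge> 1/2"
proof -
  let ?N = "\<lambda>c v. {w \<in> core phi c. phi {v, w} = c}"
  let ?D = "\<lambda>c. {1..} - core phi c"
  have cover: "\<exists>c v. v \<in> core phi c \<and> upper_density (?N c v) \<ge> 1/2"
    if "v \<in> core phi c" "u \<in> core phi d" "finite F" "{1..} \<subseteq> ?N c v \<union> ?N d u \<union> F" for c d v u F
    using upper_density_cover[OF that(4,3)] that(1,2) by blast
  have "\<exists>c v. v \<in> core phi c \<and> upper_density (?N c v) \<ge> 1/2"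
  proof (cases "\<exists>c. infinite (?D c)")
    case False
    then have fin: "finite (?D True \<union> ?D False)" by simp
    then have "\<not> {1..} \<subseteq> ?D True \<union> ?D False"
      by (meson finite_subset infinite_Ici)
    then obtain v where v: "v \<in> core phi True" "v \<in> core phi False" by blast
    have "{1..} \<subseteq> ?N True v \<union> ?N False v \<union> (?D True \<union> ?D False)" by auto
    then show ?thesis by (rule cover[OF v fin])
  next
    case True
    then obtain c where c: "infinite (?D c)" by blast
    obtain v where v: "v \<in> core phi (\<not> c)" "finite {w \<in> {1..}. phi {v, w} = c}"
      using cofinite_degree_in_core[OF c] by blast
    show ?thesis
    proof (cases "finite (?D (\<not> c))")
      case True
      let ?F = "{w \<in> {1..}. phi {v, w} = c} \<union> ?D (\<not> c)"
      have "finite ?F" using True v(2) by (rule finite_UnI[rotated])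
      \<comment> \<open>This neighbourhood alone is cofinite, so it serves as both sets of the
        cover.\<close>
      moreover have "{1..} \<subseteq> ?N (\<not> c) v \<union> ?N (\<not> c) v \<union> ?F" by auto
      ultimately show ?thesis by (rule cover[OF v(1) v(1)])
    next
      case False
      obtain u where u: "u \<in> core phi c" "finite {w \<in> {1..}. phi {u, w} = (\<not> c)}"
        using cofinite_degree_in_core[OF False] by auto
      \<comment> \<open>Outside \<open>?F\<close>, a number in \<open>core phi c\<close> is a
        neighbour of \<open>u\<close> in colour \<open>c\<close>, and one in the other core is a
        neighbour of \<open>v\<close> in the other colour.\<close>
      let ?F = "{w \<in> {1..}. phi {v, w} = c} \<union> {w \<in> {1..}. phi {u, w} = (\<not> c)}
        \<union> ({1..} - core phi c - core phi (\<not> c))"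
      have "finite ?F" using finite_UnI[OF finite_UnI[OF v(2) u(2)] finite_outside_cores] .
      moreover have "{1..} \<subseteq> ?N (\<not> c) v \<union> ?N c u \<union> ?F" by auto
      ultimately show ?thesis by (rule cover[OF v(1) u(1)])
    qed
  qed
  then show ?thesis
    using that by blast
qed

text \<open>\<open>p\<close> is the parent map of a tree with root 0, which is sent to
  \<open>v\<close>. Images stay in the core, so every later vertex has infinitely many choices. A
  neighbour of \<open>v\<close> in the core is admissible for all the infinitely many children of 0,
  hence gets used.\<close>

lemma dense_embedding_infinite_degree:
  fixes p :: "nat \<Rightarrow> nat" and phi :: "nat set \<Rightarrow> bool"
  assumes p: "\<And>n. n > 0 \<Longrightarrow> p n < n" and inf: "infinite {n. n > 0 \<and> p n = 0}"
  obtains g c where "inj g" "range g \<subseteq> {1..}" "\<And>n. n > 0 \<Longrightarrow> phi {g n, g (p n)} = c"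
    "upper_density (range g) \<ge> 1/2"
proof -
  obtain c v where v: "v \<in> core phi c" and
    dens: "upper_density {w \<in> core phi c. phi {v, w} = c} \<ge> 1/2"
    by (rule dense_neighbourhood_in_core)
  define A :: "(nat \<Rightarrow> nat) \<Rightarrow> nat \<Rightarrow> nat set" where
    "A g n = (if n = 0 then {v} else {w \<in> core phi c. phi {g (p n), w} = c})"
    for g n
  have A_core: "A g n \<subseteq> core phi c" for g n using v unfolding A_def by auto
  obtain g where g: "inj g" "\<And>n. g n \<in> A g n" "\<And>w. infinite {n. w \<in> A g n} \<Longrightarrow> w \<in> range g"
  proof (rule greedy_injection[of less_than A])
    show "wf less_than" by simp
    show "(x, y) \<in> less_than \<or> (y, x) \<in> less_than" if "x \<noteq> y" for x y using that by auto
    show "A f n = A g n" if "\<And>m. (m, n) \<in> less_than \<Longrightarrow> f m = g m" for f g n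
      using that p[of n] unfolding A_def by auto
    show "\<not> A f n \<subseteq> f ` {m. (m, n) \<in> less_than}"
      if f: "\<And>m. (m, n) \<in> less_than \<Longrightarrow> f m \<in> A f m" for f n
    proof (cases "n = 0")
      case True
      then show ?thesis unfolding A_def by simp
    next
      case False
      then have "f (p n) \<in> core phi c" using f[of "p n"] p A_core by auto
      then have "infinite (A f n)"
        using False inf_closed_core[of phi c] unfolding A_def inf_closed_def by auto
      moreover have "finite (f ` {m. (m, n) \<in> less_than})" by simp
      ultimately show ?thesis using finite_subset by blast
    qed
  qed blast
  have "g 0 = v" using g(2)[of 0] unfolding A_def by simp
  have "{w \<in> core phi c. phi {v, w} = c} \<subseteq> range g"
  proof
    fix w assume "w \<in> {w \<in> core phi c. phi {v, w} = c}"
    then have "{n. n > 0 \<and> p n = 0} \<subseteq> {n. w \<in> A g n}"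
      unfolding A_def using \<open>g 0 = v\<close> by auto
    then show "w \<in> range g" using inf g(3) by (meson finite_subset)
  qed
  then have "upper_density (range g) \<ge> 1/2"
    using dens upper_density_mono order_trans by blast
  moreover have "range g \<subseteq> {1..}"
    using g(2) A_core inf_closed_core[of phi c] unfolding inf_closed_def by blast
  moreover have "phi {g n, g (p n)} = c" if "n > 0" for n
    using g(2)[of n] that unfolding A_def by (simp add: insert_commute)
  ultimately show ?thesis using g(1) that by blast
qed

section \<open>Locally finite trees\<close>

text \<open>Shrink an infinite set step by step so that vertex \<open>n\<close> sees all of
  \<open>S (Suc n)\<close> in a single colour, and give \<open>n\<close> this colour. A set
  \<open>S m\<close> with \<open>m\<close> beyond all of \<open>F\<close> then consists of common
  neighbours.\<close>

lemma coherent_vertex_colouring: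
  fixes phi :: "nat set \<Rightarrow> bool"
  shows "\<exists>c. \<forall>b F. finite F \<longrightarrow> F \<subseteq> {u. c u = b} \<longrightarrow>
    infinite {w \<in> {1..}. \<forall>u\<in>F. phi {u, w} = b}"
proof -
  have "\<exists>S. \<forall>n. (infinite (S n) \<and> S n \<subseteq> {1..}) \<and> (\<exists>b. S (Suc n) = {w \<in> S n. phi {n, w} = b})"
  proof (rule dependent_nat_choice)
    show "\<exists>S. infinite S \<and> S \<subseteq> {1::nat..}" using infinite_Ici by blast
    fix S :: "nat set" and n :: nat
    assume S: "infinite S \<and> S \<subseteq> {1..}"
    have "S = {w \<in> S. phi {n, w} = True} \<union> {w \<in> S. phi {n, w} = False}" by blast
    then have "infinite {w \<in> S. phi {n, w} = True} \<or> infinite {w \<in> S. phi {n, w} = False}"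
      using S by (metis (no_types, lifting) finite_UnI)
    then obtain b where "infinite {w \<in> S. phi {n, w} = b}" by blast
    then show "\<exists>T. (infinite T \<and> T \<subseteq> {1..}) \<and> (\<exists>b. T = {w \<in> S. phi {n, w} = b})"
      using S by (intro exI[of _ "{w \<in> S. phi {n, w} = b}"]) blast
  qed
  then obtain S where S: "\<And>n. infinite (S n)" "\<And>n. S n \<subseteq> {1..}"
    "\<And>n. \<exists>b. S (Suc n) = {w \<in> S n. phi {n, w} = b}" by blast
  then obtain c where c: "\<And>n. S (Suc n) = {w \<in> S n. phi {n, w} = c n}" by metis
  have anti: "S n \<subseteq> S m" if "m \<le> n" for m n
    using that by (rule lift_Suc_antimono_le[rotated]) (use c in blast)
  show ?thesis
  proof (intro exI[of _ c] allI impI)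
    fix b F
    assume F: "finite F" "F \<subseteq> {u. c u = b}"
    obtain m where m: "\<And>u. u \<in> F \<Longrightarrow> Suc u \<le> m"
      using F(1) by (metis Suc_le_eq finite_nat_set_iff_bounded)
    have "S m \<subseteq> {w \<in> {1..}. \<forall>u\<in>F. phi {u, w} = b}"
    proof (intro subsetI CollectI conjI ballI)
      fix w assume w: "w \<in> S m"
      then show "w \<in> {1..}" using S(2) by blast
      fix u assume u: "u \<in> F"
      then have "w \<in> S (Suc u)" using anti[OF m] w by blast
      then show "phi {u, w} = b" using c u F(2) by blast
    qed
    then show "infinite {w \<in> {1..}. \<forall>u\<in>F. phi {u, w} = b}"
      using S(1) by (meson finite_subset)
  qed
qed

text \<open>Vertices of even depth go into \<open>P\<close>, those of odd depth to common neighbours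
  of the images of parent and children. Each element of \<open>P\<close> is admissible at infinitely
  many vertices, hence gets used.\<close>

lemma covering_embedding_locally_finite:
  fixes p :: "nat \<Rightarrow> nat" and phi :: "nat set \<Rightarrow> bool"
  assumes p: "\<And>n. n > 0 \<Longrightarrow> p n < n" and fin: "\<And>k. finite {n. p n = k}"
    and P: "P \<subseteq> {1..}" "infinite P"
    and common: "\<And>F. finite F \<Longrightarrow> F \<subseteq> P \<Longrightarrow> infinite {w \<in> {1..}. \<forall>u\<in>F. phi {u, w} = c}"
  obtains g where "inj g" "P \<subseteq> range g" "range g \<subseteq> {1..}"
    "\<And>n. n > 0 \<Longrightarrow> phi {g n, g (p n)} = c"
proof -
  \<comment> \<open>\<open>od\<close> is odd depth; the root 0 is even whatever \<open>p 0\<close>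
    is.\<close>
  have "\<exists>od. \<forall>n. od n = (n > 0 \<and> \<not> od (p n))"
  proof -
    have "\<exists>od. \<forall>n. (\<lambda>f n r. r = (n > 0 \<and> \<not> f (p n))) od n (od n)"
      by (rule dependent_wf_choice[OF wf_less_than]) (use p in auto)
    then show ?thesis by simp
  qed
  then obtain od where od: "\<And>n. od n = (n > 0 \<and> \<not> od (p n))" by blast
  \<comment> \<open>Every odd vertex is a child of an even one, so finitely many even vertices would
    leave only finitely many vertices.\<close>
  have infev: "infinite {n. \<not> od n}"
  proof
    assume ev: "finite {n. \<not> od n}"
    have "{n. od n} \<subseteq> (\<Union>k\<in>{n. \<not> od n}. {n. p n = k})" using od by blast
    then have "finite {n. od n}" using ev fin by (meson finite_UN_I finite_subset)
    with ev have "finite ({n. od n} \<union> {n. \<not> od n})" by blast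
    moreover have "{n. od n} \<union> {n. \<not> od n} = UNIV" by blast
    ultimately show False by simp
  qed
  \<comment> \<open>An odd vertex is embedded after all its children, so that it can be chosen as a common
      neighbour of its whole (finite) neighbourhood.\<close>
  define s where "s n = (if od n then n else if n = 0 then 0 else p n)" for n
  \<comment> \<open>An odd \<open>n\<close> has key \<open>(n, 1, n)\<close> and its children
    \<open>k\<close> have \<open>(n, 0, k)\<close>, just before it; its parent has first component
    at most \<open>p n < n\<close>. The last component breaks ties among siblings.\<close>
  define key where "key n = (s n, if od n then 1 else 0 :: nat, n)" for n
  define R where "R = inv_image (less_than <*lex*> less_than <*lex*> less_than) key"
  have R: "(m, n) \<in> R \<longleftrightarrow> s m < s n \<or> s m = s n \<and> (\<not> od m \<and> od n \<or> od m = od n \<and> m < n)" for m n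
    unfolding R_def key_def by auto
  \<comment> \<open>Only finitely many values are taken before \<open>n\<close>, so an infinite
    \<open>A f n\<close> is never exhausted. A predecessor \<open>m\<close> satisfies
    \<open>m \<le> s n\<close> or \<open>p m \<le> s n\<close>.\<close>
  have finR: "finite {m. (m, n) \<in> R}" for n
  proof -
    have "{m. (m, n) \<in> R} \<subseteq> {..s n} \<union> (\<Union>k\<in>{..s n}. {m. p m = k})"
      unfolding R s_def by (auto split: if_splits)
    then show ?thesis using fin by (meson finite_UN_I finite_UnI finite_atMost finite_subset)
  qed
  \<comment> \<open>The condition \<open>k > 0\<close> keeps the root from counting as a child,
    since \<open>p 0\<close> is arbitrary.\<close>
  define A :: "(nat \<Rightarrow> nat) \<Rightarrow> nat \<Rightarrow> nat set" where
    "A g n = (if od n then {w \<in> {1..}. \<forall>u \<in> g ` insert (p n) {k. k > 0 \<and> p k = n}.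
      phi {u, w} = c} else P)" for g n
  have nbr: "(k, n) \<in> R \<and> \<not> od k" if "od n" "k \<in> insert (p n) {k. k > 0 \<and> p k = n}" for n k
  proof -
    have "k = p n \<or> k > 0 \<and> p k = n" using that by auto
    then show ?thesis
    proof
      assume k: "k = p n"
      then have "k < n" "\<not> od k" using od[of n] that p by auto
      moreover have "s k \<le> k" using p[of k] unfolding s_def by auto
      ultimately show ?thesis using that unfolding R by (auto simp: s_def)
    next
      assume k: "k > 0 \<and> p k = n"
      then have "\<not> od k" using od[of k] that by auto
      then show ?thesis using k that unfolding R s_def by auto
    qed
  qed
  obtain g where g: "inj g" "\<And>n. g n \<in> A g n" "\<And>w. infinite {n. w \<in> A g n} \<Longrightarrow> w \<in> range g"
  proof (rule greedy_injection[of R A])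
    show "wf R" unfolding R_def by auto
    show "(x, y) \<in> R \<or> (y, x) \<in> R" if "x \<noteq> y" for x y
      using that unfolding R by auto
    show "A f n = A g n" if "\<And>m. (m, n) \<in> R \<Longrightarrow> f m = g m" for f g n
    proof (cases "od n")
      case True
      then have "f ` insert (p n) {k. k > 0 \<and> p k = n} = g ` insert (p n) {k. k > 0 \<and> p k = n}"
        using nbr that by (intro image_cong) blast+
      then show ?thesis unfolding A_def by simp
    qed (simp add: A_def)
    show "\<not> A f n \<subseteq> f ` {m. (m, n) \<in> R}" if f: "\<And>m. (m, n) \<in> R \<Longrightarrow> f m \<in> A f m" for f n
    proof -
      have "infinite (A f n)"
      proof (cases "od n")
        case True
        have "f ` insert (p n) {k. k > 0 \<and> p k = n} \<subseteq> P"
          using f nbr[OF True] unfolding A_def by (metis (no_types, lifting) image_subsetI)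
        moreover have "finite (f ` insert (p n) {k. k > 0 \<and> p k = n})"
          using fin[of n] by (auto intro: rev_finite_subset)
        ultimately show ?thesis unfolding A_def if_P[OF True] by (intro common)
      qed (use P in \<open>simp add: A_def\<close>)
      then show ?thesis using finR finite_subset by blast
    qed
  qed blast
  have "P \<subseteq> range g"
  proof
    fix w assume "w \<in> P"
    then have "{n. \<not> od n} \<subseteq> {n. w \<in> A g n}" unfolding A_def by auto
    then show "w \<in> range g" using infev g(3) by (meson finite_subset)
  qed
  moreover have "range g \<subseteq> {1..}"
  proof -
    have "A g n \<subseteq> {1..}" for n using P unfolding A_def by auto
    then show ?thesis using g(2) by blast
  qed
  moreover have "phi {g n, g (p n)} = c" if n: "n > 0" for n
  proof (cases "od n")
    case True
    then show ?thesis using g(2)[of n] unfolding A_def by (auto simp: insert_commute)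
  next
    case False
    \<comment> \<open>The edge above an even vertex was secured when its odd parent was
      placed.\<close>
    then have "od (p n)" using od[of n] n by auto
    then show ?thesis using g(2)[of "p n"] n unfolding A_def by auto
  qed
  ultimately show ?thesis using g(1) that by blast
qed

text \<open>One of the two classes of the coherent vertex colouring has upper density at least 1/2;
  it is taken as the set to be covered.\<close>

lemma dense_embedding_locally_finite:
  fixes p :: "nat \<Rightarrow> nat" and phi :: "nat set \<Rightarrow> bool"
  assumes p: "\<And>n. n > 0 \<Longrightarrow> p n < n" and fin: "\<And>k. finite {n. p n = k}"
  obtains g c where "inj g" "range g \<subseteq> {1..}" "\<And>n. n > 0 \<Longrightarrow> phi {g n, g (p n)} = c"
    "upper_density (range g) \<ge> 1/2"
proof -
  obtain c :: "nat \<Rightarrow> bool" where c: "\<And>b F. finite F \<Longrightarrow> F \<subseteq> {u. c u = b} \<Longrightarrow>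
      infinite {w \<in> {1..}. \<forall>u\<in>F. phi {u, w} = b}"
    using coherent_vertex_colouring[of phi] by blast
  have "{1..} \<subseteq> {u \<in> {1..}. c u = True} \<union> {u \<in> {1..}. c u = False} \<union> {}" by auto
  then obtain b where b: "upper_density {u \<in> {1..}. c u = b} \<ge> 1/2"
    using upper_density_cover by blast
  have inf: "infinite {u \<in> {1..}. c u = b}"
    using upper_density_finite b by (meson not_le)
  obtain g where g: "inj g" "{u \<in> {1..}. c u = b} \<subseteq> range g" "range g \<subseteq> {1..}"
    "\<And>n. n > 0 \<Longrightarrow> phi {g n, g (p n)} = b"
  proof (rule covering_embedding_locally_finite[OF p fin _ inf, of phi b])
    show "infinite {w \<in> {1..}. \<forall>u\<in>F. phi {u, w} = b}"
      if "finite F" "F \<subseteq> {u \<in> {1..}. c u = b}" for F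
      using that by (intro c) auto
  qed auto
  have "upper_density (range g) \<ge> 1/2"
    using b upper_density_mono[OF g(2)] by (rule order_trans)
  with g that show ?thesis by blast
qed

section \<open>Enumerating a forest\<close>

definition adj :: "'a set set \<Rightarrow> 'a set \<Rightarrow> ('a \<times> 'a) set" where
  "adj E S = {(x, y). x \<in> S \<and> y \<in> S \<and> {x, y} \<in> E}"

lemma adj_mono: "S \<subseteq> T \<Longrightarrow> adj E S \<subseteq> adj E T"
  unfolding adj_def by blast

lemma sym_rtrancl_adj: "sym ((adj E S)\<^sup>*)"
  by (rule sym_rtrancl) (auto simp: sym_def adj_def insert_commute)

text \<open>A path that returns to one of its vertices \<open>z\<close> is cut off at
  \<open>z\<close>; otherwise \<open>z\<close> is appended.\<close>

lemma simple_path: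
  assumes "(a, b) \<in> (adj E S)\<^sup>*" "a \<in> S"
  shows "\<exists>cs. cs \<noteq> [] \<and> distinct cs \<and> hd cs = a \<and> last cs = b \<and> set cs \<subseteq> S \<and>
    (\<forall>i. Suc i < length cs \<longrightarrow> {cs ! i, cs ! Suc i} \<in> E)"
  using assms(1)
proof (induction rule: rtrancl_induct)
  case base
  show ?case using assms(2) by (intro exI[of _ "[a]"]) auto
next
  case (step y z)
  then obtain cs where cs: "cs \<noteq> []" "distinct cs" "hd cs = a" "last cs = y" "set cs \<subseteq> S"
    "\<forall>i. Suc i < length cs \<longrightarrow> {cs ! i, cs ! Suc i} \<in> E" by blast
  show ?case
  proof (cases "z \<in> set cs")
    case True
    then obtain j where j: "j < length cs" "cs ! j = z" by (auto simp: in_set_conv_nth)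
    show ?thesis
    proof (intro exI[of _ "take (Suc j) cs"] conjI)
      show "last (take (Suc j) cs) = z"
        using j cs(1) by (simp add: take_Suc_conv_app_nth)
      show "set (take (Suc j) cs) \<subseteq> S" using cs(5) set_take_subset by fast
      show "\<forall>i. Suc i < length (take (Suc j) cs) \<longrightarrow>
          {take (Suc j) cs ! i, take (Suc j) cs ! Suc i} \<in> E"
        using cs(6) by auto
    qed (use cs in \<open>auto simp: hd_take\<close>)
  next
    case False
    have "z \<in> S" "{y, z} \<in> E" using step(2) unfolding adj_def by auto
    show ?thesis
    proof (intro exI[of _ "cs @ [z]"] conjI)
      show "\<forall>i. Suc i < length (cs @ [z]) \<longrightarrow> {(cs @ [z]) ! i, (cs @ [z]) ! Suc i} \<in> E"
      proof (intro allI impI)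
        fix i assume i: "Suc i < length (cs @ [z])"
        show "{(cs @ [z]) ! i, (cs @ [z]) ! Suc i} \<in> E"
        proof (cases "Suc i < length cs")
          case True
          then show ?thesis using cs(6) by (simp add: nth_append)
        next
          case False
          with i have "i = length cs - 1" "Suc i = length cs" by auto
          then have "(cs @ [z]) ! i = y" "(cs @ [z]) ! Suc i = z"
            using cs(1,4) by (auto simp: nth_append last_conv_nth)
          then show ?thesis using \<open>{y, z} \<in> E\<close> by simp
        qed
      qed
    qed (use cs False \<open>z \<in> S\<close> in auto)
  qed
qed

text \<open>A simple path in \<open>S\<close> between distinct neighbours of \<open>u\<close> would
  close through \<open>u\<close> to a cycle.\<close>

lemma forest_unique_neighbour:
  assumes "\<nexists>cs. is_cycle E cs" "(a, b) \<in> (adj E S)\<^sup>*" "a \<in> S" "u \<notin> S"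
    "{a, u} \<in> E" "{b, u} \<in> E"
  shows "a = b"
proof (rule ccontr)
  assume "a \<noteq> b"
  obtain cs where cs: "cs \<noteq> []" "distinct cs" "hd cs = a" "last cs = b" "set cs \<subseteq> S"
    "\<forall>i. Suc i < length cs \<longrightarrow> {cs ! i, cs ! Suc i} \<in> E"
    using simple_path[OF assms(2,3)] by blast
  have "length cs \<noteq> 1"
    using cs(3,4) \<open>a \<noteq> b\<close> by (auto simp: length_Suc_conv)
  with cs(1) have len: "length cs \<ge> 2"
    by (metis One_nat_def Suc_1 Suc_leI length_0_conv le_neq_implies_less neq0_conv)
  have "is_cycle E (u # cs)"
    unfolding is_cycle_def
  proof (intro conjI allI impI)
    fix i assume i: "Suc i < length (u # cs)"
    show "{(u # cs) ! i, (u # cs) ! Suc i} \<in> E"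
    proof (cases i)
      case 0
      then show ?thesis
        using assms(5) cs(1,3) by (simp add: hd_conv_nth insert_commute)
    next
      case (Suc j)
      then show ?thesis using cs(6) i by auto
    qed
  next
    show "{last (u # cs), hd (u # cs)} \<in> E" using cs(1,4) assms(6) by simp
  qed (use len cs(2,5) assms(4) in auto)
  with assms(1) show False by blast
qed

text \<open>The vertices are listed so that every initial segment meets each component of the forest in
  a connected set. The root of a further component gets its predecessor in the list as an artificial
  parent, which adds at most one child to each vertex and so preserves local finiteness.\<close>

lemma forest_enumeration:
  fixes V :: "'a set"
  assumes "forest V E" "countable V" "infinite V" "x0 \<in> V"
  obtains e :: "nat \<Rightarrow> 'a" and p where "bij_betw e UNIV V" "e 0 = x0" "\<And>n. n > 0 \<Longrightarrow> p n < n"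
    "\<And>d. d \<in> E \<Longrightarrow> \<exists>n>0. d = {e n, e (p n)}"
    "\<And>n. n > 0 \<Longrightarrow> {e n, e (p n)} \<in> E \<or> p n = n - 1"
proof -
  have acyc: "\<nexists>cs. is_cycle E cs" and simple: "simple_graph V E"
    using assms(1) unfolding forest_def by auto
  have edge: "u \<in> V \<and> v \<in> V \<and> u \<noteq> v" if "{u, v} \<in> E" for u v
    using that simple unfolding simple_graph_def by (metis doubleton_eq_iff)
  define idx where "idx = to_nat_on V"
  have idx: "inj_on idx V" unfolding idx_def using assms(2) by (rule inj_on_to_nat_on)
  \<comment> \<open>The next vertex is adjacent to a listed one or opens a component not yet met;
    this keeps the listed part of each component connected.\<close>
  define cand where "cand S = {u \<in> V - S. (\<exists>s\<in>S. {s, u} \<in> E) \<or> (\<forall>s\<in>S. (s, u) \<notin> (adj E V)\<^sup>*)}" for S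
  have cand_ne: "cand S \<noteq> {}" if "finite S" for S
  proof -
    obtain u where u: "u \<in> V - S" using Diff_infinite_finite[OF \<open>finite S\<close> assms(3)]
      by (metis all_not_in_conv finite.emptyI)
    show ?thesis
    proof (cases "\<exists>s\<in>S. (s, u) \<in> (adj E V)\<^sup>*")
      case False
      then show ?thesis using u unfolding cand_def by blast
    next
      case True
      then obtain s where s: "s \<in> S" "(s, u) \<in> (adj E V)\<^sup>*" by blast
      \<comment> \<open>A path from \<open>S\<close> either stays in \<open>S\<close>, or its first
        vertex outside is a candidate.\<close>
      from s(2) have "u \<in> S \<or> cand S \<noteq> {}"
      proof (induction rule: rtrancl_induct)
        case (step y z)
        then show ?case unfolding cand_def adj_def by auto
      qed (use s in simp)
      then show ?thesis using u by blast
    qed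
  qed
  define nxt where "nxt S = arg_min idx (\<lambda>u. u \<in> cand S)" for S
  have nxt: "nxt S \<in> cand S" "\<And>u. u \<in> cand S \<Longrightarrow> idx (nxt S) \<le> idx u" if "finite S" for S
    unfolding nxt_def using cand_ne[OF that] arg_min_nat_lemma[of "\<lambda>u. u \<in> cand S" _ idx] by blast+
  define S where "S = rec_nat {x0} (\<lambda>_ T. insert (nxt T) T)"
  have S_0: "S 0 = {x0}" and S_Suc: "S (Suc n) = insert (nxt (S n)) (S n)" for n
    unfolding S_def by simp_all
  have finS: "finite (S n)" for n by (induction n) (auto simp: S_0 S_Suc)
  note nxtS = nxt[OF finS]
  define e where "e n = (case n of 0 \<Rightarrow> x0 | Suc m \<Rightarrow> nxt (S m))" for n
  have S_e: "S n = e ` {..n}" for n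
    by (induction n) (auto simp: S_0 S_Suc e_def atMost_Suc)
  have eV: "e n \<in> V" for n
    using assms(4) nxtS(1) unfolding e_def cand_def by (auto split: nat.split)
  have e_new: "e (Suc n) \<notin> S n" for n
    using nxtS(1)[of n] unfolding e_def cand_def by auto
  have "e m \<noteq> e n" if "m < n" for m n
  proof -
    obtain k where "n = Suc k" "m \<le> k" using \<open>m < n\<close> by (cases n) auto
    then have "e m \<in> S k" "e n \<notin> S k" using e_new unfolding S_e by auto
    then show ?thesis by metis
  qed
  then have inj: "inj e" by (metis injI linorder_neqE_nat)
  have mono: "S m \<subseteq> S n" if "m \<le> n" for m n using that unfolding S_e by auto
  \<comment> \<open>From stage \<open>m\<close> on, all chosen vertices would have index at most
    \<open>idx u\<close>, but only finitely many do.\<close>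
  have never_cand: False if "u \<notin> range e" and u: "\<And>n. n \<ge> m \<Longrightarrow> u \<in> cand (S n)" for u m
  proof -
    have "idx ` e ` {Suc m..} \<subseteq> {..idx u}"
    proof (clarsimp)
      fix n assume "Suc m \<le> n"
      then obtain k where "n = Suc k" "k \<ge> m" by (metis Suc_le_D Suc_le_mono)
      then show "idx (e n) \<le> idx u" using nxtS(2) u unfolding e_def by auto
    qed
    then have "finite (idx ` e ` {Suc m..})" by (rule finite_subset) simp
    then have "finite (e ` {Suc m..})"
      using idx eV by (meson finite_imageD image_subsetI inj_on_subset)
    then show False
      using inj by (meson finite_imageD infinite_Ici inj_on_subset subset_UNIV)
  qed
  have grow: "u \<in> range e" if "{y, u} \<in> E" and y: "y \<in> range e" for y u
  proof (rule ccontr)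
    assume u: "u \<notin> range e"
    obtain m where "y \<in> S m" using y unfolding S_e by auto
    then have "u \<in> cand (S n)" if "n \<ge> m" for n
      using mono[OF that] \<open>{y, u} \<in> E\<close> u edge[of y u] unfolding cand_def S_e by auto
    then show False using never_cand u by blast
  qed
  \<comment> \<open>Listed vertices are closed under adjacency, so a missed \<open>u\<close> lies in
    an untouched component and is a candidate at every stage.\<close>
  have "range e = V"
  proof (rule ccontr)
    assume "range e \<noteq> V"
    then obtain u where u: "u \<in> V" "u \<notin> range e" using eV by blast
    have "(s, u) \<notin> (adj E V)\<^sup>*" if "s \<in> range e" for s
    proof
      assume "(s, u) \<in> (adj E V)\<^sup>*"
      then have "u \<in> range e"
        by (induction rule: rtrancl_induct) (use that grow in \<open>auto simp: adj_def\<close>)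
      with u show False by blast
    qed
    then have "u \<in> cand (S n)" for n using u unfolding cand_def S_e by auto
    then show False using never_cand u by blast
  qed
  have conn: "(a, b) \<in> (adj E (S n))\<^sup>*" if "a \<in> S n" "b \<in> S n" "(a, b) \<in> (adj E V)\<^sup>*" for a b n
    using that
  proof (induction n arbitrary: a b)
    case 0
    then show ?case by (simp add: S_0)
  next
    case (Suc n)
    let ?u = "nxt (S n)"
    have u: "?u \<in> cand (S n)" by (rule nxtS)
    have lift: "(adj E (S n))\<^sup>* \<subseteq> (adj E (S (Suc n)))\<^sup>*"
      by (intro rtrancl_mono adj_mono mono) simp
    have link: "(a, ?u) \<in> (adj E (S (Suc n)))\<^sup>*" if a: "a \<in> S n" "(a, ?u) \<in> (adj E V)\<^sup>*" for a
    proof -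
      \<comment> \<open>Since \<open>a\<close> lies in the component of \<open>?u\<close>, only the
        first alternative in \<open>cand\<close> is possible.\<close>
      obtain s where s: "s \<in> S n" "{s, ?u} \<in> E" using a u unfolding cand_def by blast
      have "(?u, s) \<in> adj E V" using s edge[of s ?u] by (auto simp: adj_def insert_commute)
      then have "(a, s) \<in> (adj E (S n))\<^sup>*" using Suc.IH a s by (meson rtrancl.rtrancl_into_rtrancl)
      moreover have "(s, ?u) \<in> adj E (S (Suc n))" using s unfolding adj_def S_Suc by auto
      ultimately show ?thesis using lift by (meson rtrancl.rtrancl_into_rtrancl subsetD)
    qed
    consider "a \<in> S n" "b \<in> S n" | "a \<in> S n" "b = ?u" | "a = ?u" "b \<in> S n" | "a = ?u" "b = ?u"
      using Suc.prems unfolding S_Suc by blast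
    then show ?case
    proof cases
      case 1
      then show ?thesis using Suc lift by blast
    next
      case 2
      then show ?thesis using link Suc.prems by blast
    next
      case 3
      then have "(b, ?u) \<in> (adj E V)\<^sup>*" using Suc.prems sym_rtrancl_adj by (metis symD)
      then show ?thesis using link 3 sym_rtrancl_adj by (metis symD)
    qed simp
  qed
  have uniq: "m = k" if "m < n" "k < n" "{e m, e n} \<in> E" "{e k, e n} \<in> E" for m k n
  proof -
    obtain l where l: "n = Suc l" using \<open>m < n\<close> by (cases n) auto
    have in_S: "e m \<in> S l" "e k \<in> S l" using that l unfolding S_e by auto
    have "(e m, e n) \<in> adj E V" "(e n, e k) \<in> adj E V"
      using that eV by (auto simp: adj_def insert_commute)
    then have "(e m, e k) \<in> (adj E (S l))\<^sup>*" using conn in_S by (meson r_into_rtrancl rtrancl_trans)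
    then have "e m = e k"
      using forest_unique_neighbour[OF acyc] in_S(1) e_new that(3,4) l by metis
    then show ?thesis using inj by (simp add: inj_eq)
  qed
  \<comment> \<open>\<open>n - 1\<close> is the artificial parent of a vertex without earlier
    neighbour; it also gives \<open>p 0 = 0\<close>.\<close>
  define p where "p n = (if \<exists>m<n. {e m, e n} \<in> E then SOME m. m < n \<and> {e m, e n} \<in> E else n - 1)" for n
  have p1: "p n < n \<and> {e (p n), e n} \<in> E" if "\<exists>m<n. {e m, e n} \<in> E" for n
    using someI_ex[OF that] that unfolding p_def by simp
  have p2: "p n = n - 1" if "\<not> (\<exists>m<n. {e m, e n} \<in> E)" for n
    using that unfolding p_def by (simp only: if_False)
  show ?thesis
  proof (rule that[of e p])
    show "bij_betw e UNIV V" unfolding bij_betw_def using inj \<open>range e = V\<close> by blast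
    show "e 0 = x0" unfolding e_def by simp
    show "p n < n" if "n > 0" for n
      using p1[of n] p2[of n] that by (cases "\<exists>m<n. {e m, e n} \<in> E") auto
    show "{e n, e (p n)} \<in> E \<or> p n = n - 1" for n
      using p1[of n] p2[of n] by (metis insert_commute)
    show "\<exists>n>0. d = {e n, e (p n)}" if "d \<in> E" for d
    proof -
      have *: "d = {e n, e (p n)} \<and> n > 0" if "d = {e m, e n}" "m < n" for m n
      proof -
        have ex: "\<exists>m<n. {e m, e n} \<in> E" using that \<open>d \<in> E\<close> by blast
        have "p n = m" using p1[OF ex] uniq[of "p n" n m] that \<open>d \<in> E\<close> by blast
        then show ?thesis using that by auto
      qed
      obtain u v where uv: "u \<noteq> v" "u \<in> V" "v \<in> V" "d = {u, v}"
        using \<open>d \<in> E\<close> simple unfolding simple_graph_def by blast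
      then obtain m n where "u = e m" "v = e n" using \<open>range e = V\<close> by blast
      then show ?thesis using uv *[of m n] *[of n m] by (metis insert_commute linorder_neqE_nat)
    qed
  qed
qed

section \<open>Transfer from the enumerated tree to the forest\<close>

theorem mainTheorem5:
  fixes V :: "'a set" and E :: "'a set set"
  assumes "forest V E" and "countable V" and "infinite V"
  shows "Rd2 V E \<ge> 1/2"
proof -
  have "\<exists>f. mono_copy phi V E f \<and> upper_density (f ` V) \<ge> 1/2" for phi
  proof -
    \<comment> \<open>\<open>x0\<close> has infinite degree if any vertex has, and is arbitrary
      otherwise.\<close>
    obtain x0 where x0: "x0 \<in> V"
      "(\<exists>x\<in>V. infinite {y. {x, y} \<in> E}) \<Longrightarrow> infinite {y. {x0, y} \<in> E}"
      using assms(3) by (metis ex_in_conv finite.emptyI)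
    obtain e :: "nat \<Rightarrow> 'a" and p where e: "bij_betw e UNIV V" "e 0 = x0"
      and p: "\<And>n. n > 0 \<Longrightarrow> p n < n"
      and edges: "\<And>d. d \<in> E \<Longrightarrow> \<exists>n>0. d = {e n, e (p n)}"
      and par: "\<And>n. n > 0 \<Longrightarrow> {e n, e (p n)} \<in> E \<or> p n = n - 1"
      using forest_enumeration[OF assms x0(1)] by metis
    have inj: "inj e" and range_e: "range e = V" using e(1) unfolding bij_betw_def by auto
    obtain g c where g: "inj g" "range g \<subseteq> {1..}" "\<And>n. n > 0 \<Longrightarrow> phi {g n, g (p n)} = c"
      "upper_density (range g) \<ge> 1/2"
    proof (cases "\<exists>x\<in>V. infinite {y. {x, y} \<in> E}")
      case True
      \<comment> \<open>Nothing precedes \<open>x0\<close> in the list, so \<open>x0\<close> is the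
        parent in each of its edges.\<close>
      have "{y. {x0, y} \<in> E} \<subseteq> e ` {n. n > 0 \<and> p n = 0}"
      proof
        fix y assume "y \<in> {y. {x0, y} \<in> E}"
        then obtain n where n: "n > 0" "{e 0, y} = {e n, e (p n)}" using edges e(2) by blast
        have "e 0 \<noteq> e n" using n(1) inj by (simp add: inj_eq)
        with n(2) have "e 0 = e (p n)" "y = e n" by (auto simp: doubleton_eq_iff)
        then show "y \<in> e ` {n. n > 0 \<and> p n = 0}"
          using n(1) inj by (auto simp: inj_eq)
      qed
      then have inf: "infinite {n. n > 0 \<and> p n = 0}"
        using x0(2)[OF True] by (meson finite_imageI finite_insert finite_subset)
      show ?thesis
        by (rule dense_embedding_infinite_degree[OF p inf, where phi = phi], assumption) (rule that)
    next
      case False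
      have fin: "finite {n. p n = k}" for k
      proof -
        \<comment> \<open>Only \<open>Suc k\<close> can have \<open>k\<close> as artificial parent,
          and \<open>0\<close> is listed because \<open>par\<close> does not cover it.\<close>
        have "{n. p n = k} \<subseteq> {0, Suc k} \<union> e -` {y. {e k, y} \<in> E}"
        proof
          fix n assume "n \<in> {n. p n = k}"
          then show "n \<in> {0, Suc k} \<union> e -` {y. {e k, y} \<in> E}"
            using par[of n] by (cases n) (auto simp: insert_commute)
        qed
        moreover have "finite {y. {e k, y} \<in> E}" using False range_e by blast
        then have "finite (e -` {y. {e k, y} \<in> E})" using inj by (rule finite_vimageI)
        ultimately show ?thesis by (meson finite.emptyI finite_UnI finite_insert finite_subset)
      qed
      show ?thesis
        by (rule dense_embedding_locally_finite[OF p fin, where phi = phi], assumption) (rule that)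
    qed
    define f where "f = g \<circ> inv e"
    have fe: "f (e n) = g n" for n unfolding f_def using inj by simp
    have "inj_on f V"
      unfolding f_def using g(1) e(1)
      by (metis bij_betw_def bij_betw_inv_into comp_inj_on inj_on_subset subset_UNIV)
    moreover have fV: "f ` V = range g"
      unfolding range_e[symmetric] by (simp add: image_image fe)
    moreover have "phi (f ` d) = c" if "d \<in> E" for d
      using edges[OF that] g(3) by (auto simp: fe)
    ultimately show ?thesis
      unfolding mono_copy_def using g(2,4) by (intro exI[of _ f]) auto
  qed
  then have "Rd_col phi V E \<ge> 1/2" for phi
    unfolding Rd_col_def by (smt (verit) Sup_upper2 mem_Collect_eq)
  then show ?thesis
    unfolding Rd2_def by (auto intro: Inf_greatest)
qed

end
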